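(* The following are equivalent for any analytic function $h$ on $\Pi$. (i) $h\in\mathcal{P}$ and the function $z\mapsto-zh(z)$ belongs to $\mathcal{P}$; (ii) $h\in\mathcal{P}$ and the Nevanlinna representation of $h$ has the form $$h(z)=c+dz+\frac1\pi\int\frac{1+tz}{t-z}\,\mathrm{d}\mu(t)$$ where (a) $d=0$, (b) $\mu((0,\infty))=0$, and (c) $c\le\frac1\pi\int t\,\mathrm{d}\mu(t)$; (iii) there exists a finite positive Borel measure $\nu$ on $[0,1]$ such that, for all $z\in\Pi$, $$h(z)=-\int\frac{1}{1-s+sz}\,\mathrm{d}\nu(s).$$
   Context: $\Pi=\{z\in\mathbb{C}:\operatorname{Im}z>0\}$. The Pick class $\mathcal{P}$ is the set of analytic functions on $\Pi$ with non-negative imaginary part. The Nevanlinna representation: for every $h\in\mathcal{P}$ there exist uniquely determined $c\in\mathbb{R}$, $d\ge0$ and a finite non-negative Borel measure $\mu$ on $\mathbb{R}$ such that $h(z)=c+dz+\frac1\pi\int_{-\infty}^{\infty}\frac{1+tz}{t-z}\,\mathrm{d}\mu(t)$ for all $z\in\Pi$. In (c), when $\mu((0,\infty))=0$, the integral $\int t\,\mathrm{d}\mu(t)$ is that of a non-positive function $\mu$-almost everywhere, so it is well defined in $[-\infty,0]$; condition (c) with $c$ real includes that it is finite. *)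

theory Defs
  imports "HOL-Probability.Probability" "HOL-Complex_Analysis.Complex_Analysis"
begin

definition upper_half_plane :: "complex set" where
  "upper_half_plane = {z. 0 < Im z}"

definition pick_class :: "(complex \<Rightarrow> complex) set" where
  "pick_class = {h. h analytic_on upper_half_plane \<and> (\<forall>z\<in>upper_half_plane. 0 \<le> Im (h z))}"

text \<open>
  For \<open>Im z > 0\<close> the kernel \<open>(1 + t z) / (t - z)\<close> is continuous and bounded in \<open>t\<close>,
  so the Bochner integral below always exists for a finite Borel measure \<open>\<mu>\<close>.
\<close>

definition nevanlinna_representation ::
    "(complex \<Rightarrow> complex) \<Rightarrow> real \<Rightarrow> real \<Rightarrow> real measure \<Rightarrow> bool" where
  "nevanlinna_representation h c d \<mu> \<longleftrightarrow>
     0 \<le> d \<and> finite_measure \<mu> \<and> sets \<mu> = sets borel \<and>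
     (\<forall>z\<in>upper_half_plane.
        h z = of_real c + of_real d * z
              + of_real (1 / pi) * (LINT t|\<mu>. (1 + of_real t * z) / (of_real t - z)))"

end

theory Submission
  imports Defs
begin

text \<open>
  The Nevanlinna representation is obtained from the Schwarz integral formula on circles of radius
  \<open>r < 1\<close>: the measures \<open>Re F(r e\<^sup>i\<^sup>\<theta>) d\<theta>\<close> have constant mass, so by Helly's selection theorem they
  converge weakly along a sequence \<open>r \<longlonglongrightarrow> 1\<close>, and a Cayley transform carries the disc to the half-plane.

  If \<open>h\<close> and \<open>- z h(z)\<close> both have non-negative imaginary part, then \<open>Im h(x + i y) / y \<le> - Re h(x + i y) / x\<close>
  for \<open>x > 0\<close>. Combined with the Schwarz--Pick inequality this bounds \<open>h\<close> near the positive half-axis,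
  and hence \<open>Im h(x + i y) = O(y)\<close> there, which forces \<open>\<mu>\<close> to vanish on the positive half-axis.
  Since \<open>Re h \<le> 0\<close> for \<open>Re z \<ge> 0\<close>, letting \<open>z\<close> tend to infinity along the diagonal gives \<open>d = 0\<close>, and along
  the imaginary axis, by Fatou's lemma, \<open>c \<le> 1 / \<pi> \<integral> t d\<mu>(t)\<close>. The substitution \<open>s = 1 / (1 - t)\<close> then
  yields the Stieltjes form, from which the two sign conditions are read off under the integral.
\<close>

section \<open>Herglotz representation on the disc\<close>

abbreviation unit_circle :: "real \<Rightarrow> complex" where
  "unit_circle x \<equiv> cis (2 * pi * x)"

lemma has_contour_integral_unit_circle_iff:
  "(f has_contour_integral I) (circlepath 0 1) \<longleftrightarrow>
     ((\<lambda>x. f (unit_circle x) * (2 * pi * \<i> * unit_circle x)) has_integral I) {0..1}"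
proof -
  have *: "exp (2 * of_real pi * \<i> * of_real x) = unit_circle x" for x
    by (simp add: cis_conv_exp mult_ac)
  show ?thesis
    unfolding has_contour_integral vector_derivative_circlepath
    unfolding circlepath * by simp
qed

lemma poisson_kernel_denominator_nonzero:
  assumes "norm w < 1"
  shows "cis \<theta> - w \<noteq> 0"
  using assms by (metis eq_iff_diff_eq_0 less_irrefl norm_cis)

text \<open>Cauchy's formula at \<open>w\<close> supplies the part with \<open>G\<close>, and
  Cauchy's theorem for the reflected point shows that the part with \<open>cnj G\<close> integrates
  to 0. Adding the two and subtracting half the mean of \<open>G - cnj G\<close> produces the
  Schwarz kernel against \<open>Re G\<close>. The parameter runs over [0,1], so normalised arc
  length becomes Lebesgue measure.\<close>

lemma Schwarz_integral_formula_disc: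
  assumes G: "G holomorphic_on cball 0 1" and w: "norm w < 1"
  shows "((\<lambda>x. (unit_circle x + w) / (unit_circle x - w) * of_real (Re (G (unit_circle x))))
           has_integral (G w - \<i> * of_real (Im (G 0)))) {0..1}"
proof -
  let ?p = unit_circle
  have Cauchy: "((\<lambda>x. G (?p x) * ?p x / (?p x - v)) has_integral G v) {0..1}"
    if "norm v < 1" for v
  proof -
    have "((\<lambda>u. G u / (u - v)) has_contour_integral (2 * of_real pi * \<i> * G v)) (circlepath 0 1)"
      using Cauchy_integral_circlepath_simple[OF G] that by simp
    then have "((\<lambda>x. G (?p x) / (?p x - v) * (2 * pi * \<i> * ?p x))
                 has_integral (2 * of_real pi * \<i> * G v)) {0..1}"
      by (simp add: has_contour_integral_unit_circle_iff)
    from has_integral_mult_right[OF this, of "1 / (2 * of_real pi * \<i>)"]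
    show ?thesis by (simp add: mult_ac)
  qed
  have mean: "((\<lambda>x. G (?p x)) has_integral G 0) {0..1}"
    using Cauchy[of 0] by simp
  \<comment> \<open>The denominator vanishes only at the reflection of \<open>w\<close>, outside the
    closed disc. Conjugating on the circle, where \<open>cnj u\<close> is \<open>1 / u\<close>,
    turns this into an identity for \<open>cnj G\<close>.\<close>
  have "((\<lambda>u. cnj w * G u / (1 - cnj w * u)) has_contour_integral 0) (circlepath 0 1)"
  proof (rule Cauchy_theorem_convex_simple)
    have "1 - cnj w * u \<noteq> 0" if "u \<in> cball 0 1" for u
    proof
      assume "1 - cnj w * u = 0"
      then have "norm (cnj w * u) = 1" by (metis eq_iff_diff_eq_0 norm_one)
      moreover have "norm (cnj w * u) \<le> norm w * 1"
        unfolding norm_mult complex_mod_cnj by (rule mult_left_mono) (use that in auto)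
      ultimately show False using w by simp
    qed
    then show "(\<lambda>u. cnj w * G u / (1 - cnj w * u)) holomorphic_on cball 0 1"
      by (intro holomorphic_intros G) auto
  qed auto
  then have "((\<lambda>x. cnj w * G (?p x) / (1 - cnj w * ?p x) * (2 * pi * \<i> * ?p x))
               has_integral 0) {0..1}"
    by (simp add: has_contour_integral_unit_circle_iff)
  from has_integral_mult_right[OF this, of "1 / (2 * of_real pi * \<i>)"]
  have "((\<lambda>x. cnj w * G (?p x) * ?p x / (1 - cnj w * ?p x)) has_integral 0) {0..1}"
    by (simp add: mult_ac)
  from has_integral_linear[OF this bounded_linear_cnj]
  have "((\<lambda>x. cnj (cnj w * G (?p x) * ?p x / (1 - cnj w * ?p x))) has_integral 0) {0..1}"
    by (simp add: o_def)
  then have conj: "((\<lambda>x. w * cnj (G (?p x)) / (?p x - w)) has_integral 0) {0..1}"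
  proof (rule has_integral_eq[rotated])
    fix x :: real
    have "cnj (?p x) * ?p x = 1"
      by (simp add: cis_cnj cis_mult)
    moreover have "cnj (?p x) \<noteq> 0" by simp
    ultimately have "(1 - w * cnj (?p x)) = cnj (?p x) * (?p x - w)"
      by (simp add: algebra_simps)
    then show "cnj (cnj w * G (?p x) * ?p x / (1 - cnj w * ?p x)) = w * cnj (G (?p x)) / (?p x - w)"
      by simp
  qed
  have mean': "((\<lambda>x. cnj (G (?p x))) has_integral cnj (G 0)) {0..1}"
    using has_integral_linear[OF mean bounded_linear_cnj] by (simp add: o_def)
  have "((\<lambda>x. G (?p x) * ?p x / (?p x - w) + w * cnj (G (?p x)) / (?p x - w)
              - (G (?p x) - cnj (G (?p x))) * (1 / 2))
          has_integral (G w + 0 - (G 0 - cnj (G 0)) * (1 / 2))) {0..1}"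
    by (intro has_integral_add has_integral_diff has_integral_mult_left Cauchy conj mean mean' w)
  also have "G w + 0 - (G 0 - cnj (G 0)) * (1 / 2) = G w - \<i> * of_real (Im (G 0))"
    by (simp add: complex_diff_cnj)
  finally show ?thesis
  proof (rule has_integral_eq[rotated])
    fix x :: real
    have R: "of_real (Re (G (?p x))) = (G (?p x) + cnj (G (?p x))) / 2"
      by (simp add: complex_add_cnj)
    show "G (?p x) * ?p x / (?p x - w) + w * cnj (G (?p x)) / (?p x - w)
            - (G (?p x) - cnj (G (?p x))) * (1 / 2)
          = (?p x + w) / (?p x - w) * of_real (Re (G (?p x)))"
      unfolding R using poisson_kernel_denominator_nonzero[OF w, of "2 * pi * x"]
      by (simp add: divide_simps) (simp add: algebra_simps)
  qed
qed

lemma Schwarz_kernel_bound: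
  assumes "norm w < 1"
  shows "norm ((cis \<theta> + w) / (cis \<theta> - w)) \<le> 2 / (1 - norm w)"
proof -
  have "norm (cis \<theta> + w) \<le> 2"
    using norm_triangle_ineq[of "cis \<theta>" w] assms by simp
  moreover have "1 - norm w \<le> norm (cis \<theta> - w)"
    using norm_triangle_ineq2[of "cis \<theta>" w] by simp
  ultimately show ?thesis
    unfolding norm_divide using assms by (intro frac_le) auto
qed

text \<open>A non-constant \<open>F\<close> is open, so its image would contain points just to the
  left of \<open>F a\<close>, with negative real part. This settles the degenerate case
  \<open>Re (F 0) = 0\<close> of the Herglotz representation, in which no normalisation to mass 1 is
  possible.\<close>

lemma holomorphic_Re_nonneg_constant:
  assumes hol: "F holomorphic_on S" and S: "open S" "connected S" "a \<in> S"
    and nonneg: "\<And>z. z \<in> S \<Longrightarrow> 0 \<le> Re (F z)" and zero: "Re (F a) = 0"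
    and z: "z \<in> S"
  shows "F z = F a"
proof -
  have "F constant_on S"
  proof (rule ccontr)
    assume "\<not> F constant_on S"
    then have "open (F ` S)"
      using open_mapping_thm[OF hol S(1,2,1)] by auto
    then obtain e where e: "e > 0" "ball (F a) e \<subseteq> F ` S"
      using S(3) unfolding open_contains_ball by blast
    have "F a - of_real (e / 2) \<in> ball (F a) e"
      using e by (simp add: dist_norm)
    then have "F a - of_real (e / 2) \<in> F ` S" using e by blast
    then have "0 \<le> Re (F a - of_real (e / 2))" using nonneg by force
    then show False using e zero by simp
  qed
  then show ?thesis using z S(3) by (metis constant_on_def)
qed

lemma isCont_Schwarz_kernel:
  assumes "norm w < 1"
  shows "isCont (\<lambda>x. (unit_circle x + w) / (unit_circle x - w)) x"
  using poisson_kernel_denominator_nonzero[OF assms, of "2 * pi * x"]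
  by (intro continuous_intros) (simp_all add: cis_conv_exp)

theorem Herglotz_representation_disc:
  assumes F: "F holomorphic_on ball 0 1" and nonneg: "\<And>w. norm w < 1 \<Longrightarrow> 0 \<le> Re (F w)"
  obtains M :: "real measure" where "finite_measure M" "sets M = sets borel"
    "\<And>w. norm w < 1 \<Longrightarrow>
       F w = \<i> * of_real (Im (F 0)) + (LINT x|M. (unit_circle x + w) / (unit_circle x - w))"
proof (cases "Re (F 0) = 0")
  case True
  have const: "F w = F 0" if "norm w < 1" for w
    by (rule holomorphic_Re_nonneg_constant[OF F]) (use that True nonneg in auto)
  show thesis
  proof (rule that[of "null_measure borel"])
    show "finite_measure (null_measure borel :: real measure)"
      by (rule finite_measureI) simp
    fix w :: complex assume "norm w < 1"
    then show "F w = \<i> * of_real (Im (F 0))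
        + (LINT x|null_measure borel. (unit_circle x + w) / (unit_circle x - w))"
      using True by (subst const) (simp_all add: complex_eq_iff)
  qed simp
next
  case False
  let ?p = unit_circle
  \<comment> \<open>The common mass of the measures on all circles, by the mean value property.
    Dividing by it gives probability measures, for which Helly's theorem is available.\<close>
  define m where "m = Re (F 0)"
  have m: "m > 0" using False nonneg[of 0] by (simp add: m_def)
  \<comment> \<open>The shift by 2 makes \<open>r n\<close> strictly positive already for
    \<open>n = 0\<close>.\<close>
  define r where "r n = 1 - 1 / real (n + 2)" for n
  have r: "0 < r n" "r n < 1" for n by (simp_all add: r_def divide_simps)
  have r_lim: "r \<longlonglongrightarrow> 1"
    unfolding r_def by real_asymp
  \<comment> \<open>The dilation is holomorphic on the closed disc, as the Schwarz formula
    requires.\<close>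
  define G where "G n w = F (of_real (r n) * w)" for n w
  have G: "G n holomorphic_on cball 0 1" for n
  proof -
    have "of_real (r n) * w \<in> ball 0 1" if "w \<in> cball 0 1" for w :: complex
    proof -
      have "r n * norm w \<le> r n * 1"
        by (rule mult_left_mono) (use that r[of n] in auto)
      with r[of n] have "r n * norm w < 1" by linarith
      with r[of n] show ?thesis by (simp add: norm_mult)
    qed
    then show ?thesis
      unfolding G_def
      by (intro holomorphic_on_compose_gen[OF _ F, unfolded o_def] holomorphic_intros) auto
  qed
  define \<rho> where "\<rho> n x = indicator {0..1} x * (Re (G n (?p x)) / m)" for n x
  have G_cont: "continuous_on UNIV (\<lambda>x. G n (?p x))" for n
    by (rule continuous_on_compose2[OF holomorphic_on_imp_continuous_on[OF G]])
      (auto intro!: continuous_intros)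
  have \<rho>_meas[measurable]: "\<rho> n \<in> borel_measurable borel" for n
    unfolding \<rho>_def
    by (intro borel_measurable_times borel_measurable_indicator borel_measurable_continuous_onI
        continuous_intros G_cont) (use m in auto)
  have \<rho>_nonneg: "0 \<le> \<rho> n x" for n x
    unfolding \<rho>_def G_def using m r[of n]
    by (intro mult_nonneg_nonneg divide_nonneg_pos nonneg) (auto simp: norm_mult)
  define \<mu> where "\<mu> n = density lborel (\<rho> n)" for n
  have integral_\<mu>: "integral\<^sup>L (\<mu> n) f = I /\<^sub>R m"
    if f: "continuous_on UNIV f"
      and I: "((\<lambda>x. f x * of_real (Re (G n (?p x)))) has_integral I) {0..1}" for n f and I :: complex
  proof -
    have [measurable]: "f \<in> borel_measurable borel"
      by (rule borel_measurable_continuous_onI[OF f])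
    have "continuous_on {0..1} (\<lambda>x. f x * of_real (Re (G n (?p x))))"
      by (intro continuous_intros continuous_on_subset[OF f] continuous_on_subset[OF G_cont]) auto
    then have "set_integrable lborel {0..1} (\<lambda>x. f x * of_real (Re (G n (?p x))))"
      by (rule borel_integrable_atLeastAtMost')
    from set_borel_integral_eq_integral(2)[OF this] integral_unique[OF I]
    have *: "(LINT x:{0..1}|lborel. f x * of_real (Re (G n (?p x)))) = I" by simp
    have "integral\<^sup>L (\<mu> n) f = (LINT x|lborel. \<rho> n x *\<^sub>R f x)"
      unfolding \<mu>_def by (subst integral_density) (auto simp: \<rho>_nonneg)
    also have "\<dots> = (LINT x|lborel. (indicator {0..1} x *\<^sub>R (f x * of_real (Re (G n (?p x))))) /\<^sub>R m)"
      by (intro Bochner_Integration.integral_cong) (auto simp: \<rho>_def scaleR_conv_of_real divide_simps)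
    also have "\<dots> = I /\<^sub>R m"
      unfolding integral_scaleR_right using * by (simp add: set_lebesgue_integral_def)
    finally show ?thesis .
  qed
  have prob: "prob_space (\<mu> n)" for n
  proof
    have i: "((\<lambda>x. Re (G n (?p x))) has_integral m) {0..1}"
    proof -
      \<comment> \<open>This is the Schwarz formula at 0, where the kernel is identically 1.\<close>
      have "((\<lambda>x. of_real (Re (G n (?p x))) :: complex) has_integral of_real m) {0..1}"
      proof -
        have "(?p x + 0) / (?p x - 0) * of_real (Re (G n (?p x))) = of_real (Re (G n (?p x)))" for x
          by (simp only: add_0_right diff_zero divide_self[OF cis_neq_zero] mult_1_left)
        moreover have "G n 0 - \<i> * of_real (Im (G n 0)) = of_real m"
          by (simp add: m_def G_def complex_eq_iff)
        ultimately show ?thesis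
          using Schwarz_integral_formula_disc[OF G, of 0 n] by simp
      qed
      from has_integral_linear[OF this bounded_linear_Re] show ?thesis by (simp add: o_def)
    qed
    have "((\<lambda>x. if x \<in> {0..1} then Re (G n (?p x)) / m else 0) has_integral (m / m)) UNIV"
      using has_integral_divide[OF i, of m] by (simp only: has_integral_restrict_UNIV)
    also have "(\<lambda>x. if x \<in> {0..1} then Re (G n (?p x)) / m else 0) = \<rho> n"
      by (auto simp: \<rho>_def fun_eq_iff)
    finally have "(\<integral>\<^sup>+x. \<rho> n x \<partial>lborel) = 1"
      using m by (subst nn_integral_has_integral_lborel[of "\<rho> n" 1]) (auto simp: \<rho>_nonneg)
    then show "emeasure (\<mu> n) (space (\<mu> n)) = 1"
      by (simp add: \<mu>_def emeasure_density)
  qed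
  have dist: "real_distribution (\<mu> n)" for n
    using prob by (simp add: real_distribution_def real_distribution_axioms_def \<mu>_def)
  have "tight \<mu>"
    unfolding tight_def
  proof (intro conjI allI impI dist)
    fix \<epsilon> :: real assume \<epsilon>: "\<epsilon> > 0"
    \<comment> \<open>All mass lies in [0,1], so one interval serves every \<epsilon>. Tightness
      asks for left-open intervals, hence a left end below 0.\<close>
    have "measure (\<mu> n) {-1<..2} = 1" for n
    proof -
      interpret prob_space "\<mu> n" by (rule prob)
      have "AE x in \<mu> n. x \<in> {-1<..2}"
      proof -
        have "(\<lambda>x. ennreal (\<rho> n x)) \<in> borel_measurable lborel" by simp
        from AE_density[OF this] show ?thesis
          unfolding \<mu>_def by (auto simp: \<rho>_def indicator_def)
      qed
      then show ?thesis by (subst prob_eq_1) (auto simp: \<mu>_def)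
    qed
    then show "\<exists>a b. a < b \<and> (\<forall>n. 1 - \<epsilon> < measure (\<mu> n) {a<..b})"
      using \<epsilon> by (intro exI[of _ "-1"] exI[of _ 2]) auto
  qed
  from tight_imp_convergent_subsubsequence[OF this strict_mono_id]
  obtain s N where s: "strict_mono s" and N: "real_distribution N"
    and conv: "weak_conv_m (\<mu> \<circ> id \<circ> s) N" by auto
  interpret N: real_distribution N by (rule N)
  have N_integral: "F w = \<i> * of_real (Im (F 0)) + m *\<^sub>R (LINT x|N. (?p x + w) / (?p x - w))"
    if w: "norm w < 1" for w
  proof -
    let ?k = "\<lambda>x. (?p x + w) / (?p x - w)"
    have lim: "(\<lambda>n. integral\<^sup>L ((\<mu> \<circ> id \<circ> s) n) ?k) \<longlonglongrightarrow> integral\<^sup>L N ?k"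
      by (rule weak_conv_imp_integral_bdd_continuous_conv[OF _ N conv
            isCont_Schwarz_kernel[OF w] Schwarz_kernel_bound[OF w]]) (simp add: dist)
    have eq: "integral\<^sup>L ((\<mu> \<circ> id \<circ> s) n) ?k
        = (F (of_real (r (s n)) * w) - \<i> * of_real (Im (F 0))) /\<^sub>R m" for n
    proof -
      have "integral\<^sup>L (\<mu> (s n)) ?k = (G (s n) w - \<i> * of_real (Im (G (s n) 0))) /\<^sub>R m"
        by (rule integral_\<mu>[OF continuous_at_imp_continuous_on Schwarz_integral_formula_disc[OF G w]])
          (use isCont_Schwarz_kernel[OF w] in blast)
      then show ?thesis by (simp add: G_def)
    qed
    have lim': "(\<lambda>n. (F (of_real (r (s n)) * w) - \<i> * of_real (Im (F 0))) /\<^sub>R m)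
        \<longlonglongrightarrow> integral\<^sup>L N ?k"
      using lim unfolding eq .
    have "isCont F w"
      using continuous_on_interior[OF holomorphic_on_imp_continuous_on[OF F], of w] w by simp
    moreover have "(\<lambda>n. of_real (r (s n)) * w) \<longlonglongrightarrow> of_real 1 * w"
      using LIMSEQ_subseq_LIMSEQ[OF r_lim s] by (intro tendsto_mult tendsto_of_real tendsto_const) (simp add: o_def)
    ultimately have "(\<lambda>n. F (of_real (r (s n)) * w)) \<longlonglongrightarrow> F w"
      by (intro isCont_tendsto_compose[of w F]) simp_all
    then have "(\<lambda>n. (F (of_real (r (s n)) * w) - \<i> * of_real (Im (F 0))) /\<^sub>R m)
        \<longlonglongrightarrow> (F w - \<i> * of_real (Im (F 0))) /\<^sub>R m"
      by (intro tendsto_scaleR tendsto_diff tendsto_const)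
    from LIMSEQ_unique[OF lim' this]
    have "m *\<^sub>R integral\<^sup>L N ?k = F w - \<i> * of_real (Im (F 0))"
      using m by simp
    then show ?thesis by (simp only: add_diff_cancel_left' diff_add_cancel add_diff_eq)
  qed
  show thesis
  \<comment> \<open>Multiplying the weak limit by \<open>m\<close> undoes the normalisation.\<close>
  proof (rule that[of "density N (\<lambda>_. m)"])
    show "finite_measure (density N (\<lambda>_. m))"
      by (intro finite_measureI) (simp add: emeasure_density ennreal_mult_eq_top_iff)
    fix w :: complex assume w: "norm w < 1"
    have "(\<lambda>x. (?p x + w) / (?p x - w)) \<in> borel_measurable borel"
      using isCont_Schwarz_kernel[OF w]
      by (intro borel_measurable_continuous_onI continuous_at_imp_continuous_on) blast
    then have "(LINT x|density N (\<lambda>_. m). (?p x + w) / (?p x - w))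
        = (LINT x|N. m *\<^sub>R ((?p x + w) / (?p x - w)))"
      using m by (intro integral_density) auto
    then show "F w = \<i> * of_real (Im (F 0)) + (LINT x|density N (\<lambda>_. m). (?p x + w) / (?p x - w))"
      unfolding integral_scaleR_right by (metis N_integral[OF w])
  qed simp
qed

section \<open>Nevanlinna representation on the half-plane\<close>

abbreviation nevanlinna_kernel :: "complex \<Rightarrow> real \<Rightarrow> complex" where
  "nevanlinna_kernel z t \<equiv> (1 + of_real t * z) / (of_real t - z)"

lemma of_real_minus_nonreal:
  assumes "Im z > 0"
  shows "of_real t - z \<noteq> 0" "Im z \<le> norm (of_real t - z)"
proof -
  show "Im z \<le> norm (of_real t - z)"
    using abs_Im_le_cmod[of "of_real t - z"] assms by simp
  with assms show "of_real t - z \<noteq> 0" by auto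
qed

text \<open>Splitting off \<open>z\<close>, the limit of the kernel as t tends to infinity, leaves
  \<open>(1 + z\<^sup>2) / (t - z)\<close>, whose denominator has modulus at least
  \<open>Im z\<close>. The bound is uniform in \<open>t\<close> and serves both integrability and
  dominated convergence.\<close>

lemma nevanlinna_kernel_bound:
  assumes "Im z > 0"
  shows "norm (nevanlinna_kernel z t) \<le> norm z + norm (1 + z\<^sup>2) / Im z"
proof -
  have "nevanlinna_kernel z t = z + (1 + z\<^sup>2) / (of_real t - z)"
    using of_real_minus_nonreal(1)[OF assms, of t]
    by (simp add: divide_simps) (simp add: algebra_simps power2_eq_square)
  also have "norm \<dots> \<le> norm z + norm ((1 + z\<^sup>2) / (of_real t - z))"
    by (rule norm_triangle_ineq)
  also have "norm ((1 + z\<^sup>2) / (of_real t - z)) \<le> norm (1 + z\<^sup>2) / Im z"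
    unfolding norm_divide using of_real_minus_nonreal(2)[OF assms, of t] assms
    by (intro divide_left_mono) (auto intro!: mult_pos_pos elim: less_le_trans)
  finally show ?thesis by simp
qed

lemma integrable_nevanlinna_kernel:
  assumes "finite_measure \<mu>" "sets \<mu> = sets borel" "Im z > 0"
  shows "integrable \<mu> (nevanlinna_kernel z)"
proof -
  interpret finite_measure \<mu> by fact
  show ?thesis
    by (rule integrable_const_bound[OF AE_I2[OF nevanlinna_kernel_bound[OF assms(3)]]])
      (simp add: measurable_cong_sets[OF assms(2) refl])
qed

section \<open>The Cayley transform between disc and half-plane\<close>

lemma Cayley_transform:
  assumes "Im z > 0"
  defines "w \<equiv> (z - \<i>) / (z + \<i>)"
  shows "norm w < 1" "\<i> * (1 + w) / (1 - w) = z"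
proof -
  have ne: "z + \<i> \<noteq> 0" using assms(1) by (auto simp: complex_eq_iff)
  have "(norm (z - \<i>))\<^sup>2 < (norm (z + \<i>))\<^sup>2"
    unfolding cmod_power2 using assms(1) by (simp add: power2_eq_square algebra_simps)
  then have "norm (z - \<i>) < norm (z + \<i>)"
    by (rule power_less_imp_less_base) simp
  then show "norm w < 1" using ne by (simp add: w_def norm_divide divide_simps)
  have "1 - w = 2 * \<i> / (z + \<i>)" "1 + w = 2 * z / (z + \<i>)"
    using ne by (simp_all add: w_def field_simps)
  then have "\<i> * (1 + w) / (1 - w) = \<i> * (2 * z / (z + \<i>)) / (2 * \<i> / (z + \<i>))"
    by (simp only:)
  then show "\<i> * (1 + w) / (1 - w) = z"
    using ne by simp
qed

lemma Im_inverse_Cayley_transform_pos: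
  assumes "norm w < 1"
  shows "Im (\<i> * (1 + w) / (1 - w)) > 0"
proof -
  have "Im (\<i> * (1 + w) / (1 - w)) = (1 - (norm w)\<^sup>2) / (norm (1 - w))\<^sup>2"
    unfolding Im_divide cmod_power2 by (simp add: power2_eq_square algebra_simps)
  moreover have "(norm w)\<^sup>2 < 1" using assms by (simp add: abs_square_less_1)
  moreover have "norm (1 - w) > 0" using assms by auto
  ultimately show ?thesis by simp
qed

text \<open>The Cayley map sends the boundary point \<open>cis (2 * \<theta>)\<close> to
  \<open>- cot \<theta>\<close>, and the Schwarz kernel to the Nevanlinna kernel there. The point 1
  of the circle goes to infinity, where the value is \<open>z\<close>; its mass will become the
  linear term of the representation. Working with the half angle makes a factor \<open>2 * e\<close>
  cancel from numerator and denominator.\<close>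

lemma Schwarz_kernel_Cayley_transform:
  assumes z: "Im z > 0"
  defines "w \<equiv> (z - \<i>) / (z + \<i>)"
  shows "\<i> * ((cis (2 * \<theta>) + w) / (cis (2 * \<theta>) - w)) =
           (if sin \<theta> = 0 then z else nevanlinna_kernel z (- cos \<theta> / sin \<theta>))"
proof -
  have ne: "z + \<i> \<noteq> 0" using z by (auto simp: complex_eq_iff)
  define a b :: complex where "a = of_real (cos \<theta>)" and "b = of_real (sin \<theta>)"
  have ab: "a\<^sup>2 + b\<^sup>2 = 1"
    unfolding a_def b_def by (metis of_real_1 of_real_add of_real_power sin_cos_squared_add2)
  define e where "e = a + \<i> * b"
  have e: "cis (2 * \<theta>) = e\<^sup>2" "e \<noteq> 0"
  proof -
    have "e = cis \<theta>" by (simp add: e_def a_def b_def complex_eq_iff)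
    then show "cis (2 * \<theta>) = e\<^sup>2" "e \<noteq> 0" by (simp_all add: power2_eq_square cis_mult)
  qed
  have den: "e\<^sup>2 * (z + \<i>) - (z - \<i>) = 2 * \<i> * e * (z * b + a)"
    using ab i_squared unfolding e_def by algebra
  have num: "e\<^sup>2 * (z + \<i>) + (z - \<i>) = 2 * e * (z * a - b)"
    using ab i_squared unfolding e_def by algebra
  have zba: "z * b + a \<noteq> 0"
  proof
    assume *: "z * b + a = 0"
    have "Im (z * b + a) = Im z * sin \<theta>" by (simp add: a_def b_def)
    with * z have "sin \<theta> = 0" by simp
    with * have "cos \<theta> = 0" by (simp add: a_def b_def)
    with \<open>sin \<theta> = 0\<close> show False using sin_cos_squared_add[of \<theta>] by simp
  qed
  have "(e\<^sup>2 + w) / (e\<^sup>2 - w) = (e\<^sup>2 * (z + \<i>) + (z - \<i>)) / (e\<^sup>2 * (z + \<i>) - (z - \<i>))"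
  proof -
    have "e\<^sup>2 + w = (e\<^sup>2 * (z + \<i>) + (z - \<i>)) / (z + \<i>)"
      "e\<^sup>2 - w = (e\<^sup>2 * (z + \<i>) - (z - \<i>)) / (z + \<i>)"
      unfolding w_def using ne by (simp_all add: add_divide_distrib diff_divide_distrib)
    then show ?thesis using ne by simp
  qed
  also have "\<dots> = (z * a - b) / (\<i> * (z * b + a))"
    unfolding num den using e by simp
  finally have *: "\<i> * ((cis (2 * \<theta>) + w) / (cis (2 * \<theta>) - w)) = (z * a - b) / (z * b + a)"
    using zba by (simp add: e)
  show ?thesis
  proof (cases "sin \<theta> = 0")
    case True
    then have "b = 0" "a \<noteq> 0" using zba by (auto simp: b_def)
    with * True show ?thesis by simp
  next
    case False
    then have b: "b \<noteq> 0" by (simp add: b_def)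
    have "nevanlinna_kernel z (- cos \<theta> / sin \<theta>) = (1 + (- a / b) * z) / (- a / b - z)"
      by (simp add: a_def b_def)
    also have "\<dots> = (z * a - b) / (z * b + a)"
    proof -
      have "1 + (- a / b) * z = - (z * a - b) / b" "- a / b - z = - (z * b + a) / b"
        using b by (simp_all add: field_simps)
      moreover have "(- X / b) / (- Y / b) = X / Y" for X Y :: complex
        using b by simp
      ultimately show ?thesis by metis
    qed
    finally show ?thesis using * False by simp
  qed
qed

theorem nevanlinna_representation_exists:
  assumes h: "h \<in> pick_class"
  obtains c d \<mu> where "nevanlinna_representation h c d \<mu>"
proof -
  let ?C = "\<lambda>w. \<i> * (1 + w) / (1 - w)"
  \<comment> \<open>The factor \<open>- \<i>\<close> turns a non-negative imaginary part into a
    non-negative real part.\<close>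
  define F where "F w = - \<i> * h (?C w)" for w
  have "h holomorphic_on upper_half_plane"
    using h by (auto simp: pick_class_def intro: analytic_imp_holomorphic)
  then have F: "F holomorphic_on ball 0 1"
    unfolding F_def
    by (intro holomorphic_intros holomorphic_on_compose_gen[of ?C _ h, unfolded o_def])
      (auto simp: upper_half_plane_def intro!: Im_inverse_Cayley_transform_pos)
  have F_nonneg: "0 \<le> Re (F w)" if "norm w < 1" for w
    using h Im_inverse_Cayley_transform_pos[OF that]
    by (auto simp: F_def pick_class_def upper_half_plane_def)
  obtain M :: "real measure" where M: "finite_measure M" "sets M = sets borel"
    and rep: "\<And>w. norm w < 1 \<Longrightarrow>
       F w = \<i> * of_real (Im (F 0)) + (LINT x|M. (unit_circle x + w) / (unit_circle x - w))"
    by (rule Herglotz_representation_disc[OF F F_nonneg]) (assumption, rule that)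
  interpret M: finite_measure M by fact
  have [measurable_cong]: "sets M = sets borel" by fact
  have space_M: "space M = UNIV" using sets_eq_imp_space_eq[OF M(2)] by simp
  \<comment> \<open>The complement of \<open>A\<close> consists of the integers, the parameters of
    the circle point that corresponds to infinity.\<close>
  define A where "A = {x::real. sin (pi * x) \<noteq> 0}"
  define t where "t x = - cos (pi * x) / sin (pi * x)" for x
  have [measurable]: "A \<in> sets borel" "t \<in> borel_measurable borel"
    unfolding A_def t_def by measurable
  \<comment> \<open>The factor \<open>pi\<close> compensates the \<open>1 / pi\<close> in front of
    the Nevanlinna integral.\<close>
  define N where "N = density M (\<lambda>x. pi * indicator A x)"
  define \<mu> where "\<mu> = distr N borel t"
  have [measurable_cong]: "sets N = sets borel" by (simp add: N_def M)
  \<comment> \<open>Multiplying the Herglotz formula by \<open>\<i>\<close> recovers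
    \<open>h\<close> and turns the constant \<open>\<i> * Im (F 0)\<close> into
    \<open>- Im (F 0)\<close>. The mass at infinity is the coefficient of \<open>z\<close>.\<close>
  have "nevanlinna_representation h (- Im (F 0)) (measure M (- A)) \<mu>"
    unfolding nevanlinna_representation_def
  proof (intro conjI ballI)
    have "finite_measure N"
    proof
      have "emeasure N (space N)
          = (\<integral>\<^sup>+x. ennreal (pi * indicator A x) * indicator (space M) x \<partial>M)"
        unfolding N_def by (subst emeasure_density) auto
      also have "\<dots> \<le> (\<integral>\<^sup>+x. ennreal pi \<partial>M)"
        by (rule nn_integral_mono) (simp split: split_indicator)
      finally have "emeasure N (space N) \<le> (\<integral>\<^sup>+x. ennreal pi \<partial>M)" .
      moreover have "(\<integral>\<^sup>+x. ennreal pi \<partial>M) \<noteq> \<top>"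
        by (simp add: ennreal_mult_eq_top_iff)
      ultimately show "emeasure N (space N) \<noteq> \<infinity>"
        using neq_top_trans unfolding infinity_ennreal_def by blast
    qed
    then show "finite_measure \<mu>"
      unfolding \<mu>_def by (rule finite_measure.finite_measure_distr) measurable
    fix z assume "z \<in> upper_half_plane"
    then have z: "Im z > 0" by (simp add: upper_half_plane_def)
    define w where "w = (z - \<i>) / (z + \<i>)"
    note w = Cayley_transform[OF z, folded w_def]
    let ?k = "\<lambda>x. indicator A x *\<^sub>R nevanlinna_kernel z (t x)"
    have int: "integrable M ?k"
      by (rule M.integrable_const_bound[where B = "norm z + norm (1 + z\<^sup>2) / Im z"])
        (use z in \<open>auto simp: indicator_def intro!: nevanlinna_kernel_bound\<close>)
    have "h z = \<i> * F w"
      unfolding F_def w(2) by simp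
    also have "\<dots> = of_real (- Im (F 0)) + (LINT x|M. \<i> * ((unit_circle x + w) / (unit_circle x - w)))"
      unfolding rep[OF w(1)]
      by (simp only: distrib_left integral_mult_right_zero complex_i_mult_minus of_real_minus)
    also have "(LINT x|M. \<i> * ((unit_circle x + w) / (unit_circle x - w)))
        = (LINT x|M. indicator (- A) x *\<^sub>R z + ?k x)"
    proof (rule Bochner_Integration.integral_cong[OF refl])
      fix x :: real
      show "\<i> * ((unit_circle x + w) / (unit_circle x - w)) = indicator (- A) x *\<^sub>R z + ?k x"
        using Schwarz_kernel_Cayley_transform[OF z, of "pi * x", folded w_def]
        by (simp add: mult.assoc A_def t_def indicator_def)
    qed
    also have "\<dots> = measure M (- A) *\<^sub>R z + (LINT x|M. ?k x)"
    proof -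
      have ind: "integrable M (indicator (- A) :: real \<Rightarrow> real)"
        by (rule M.integrable_const_bound[where B = 1]) (auto split: split_indicator)
      have "(LINT x|M. indicator (- A) x *\<^sub>R z) = measure M (- A) *\<^sub>R z"
        using ind by (subst integral_scaleR_left) (simp_all add: space_M)
      then show ?thesis
        using int ind by (subst Bochner_Integration.integral_add) simp_all
    qed
    also have "(LINT x|M. ?k x) = of_real (1 / pi) * (LINT t|\<mu>. nevanlinna_kernel z t)"
    proof -
      have "(LINT t|\<mu>. nevanlinna_kernel z t) = (LINT x|N. nevanlinna_kernel z (t x))"
        unfolding \<mu>_def by (rule integral_distr) measurable
      also have "\<dots> = (LINT x|M. (pi * indicator A x) *\<^sub>R nevanlinna_kernel z (t x))"
        unfolding N_def by (rule integral_density) auto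
      also have "\<dots> = (LINT x|M. pi *\<^sub>R ?k x)" by simp
      also have "\<dots> = pi *\<^sub>R (LINT x|M. ?k x)" by (rule integral_scaleR_right)
      finally show ?thesis by (simp add: scaleR_conv_of_real)
    qed
    finally show "h z = of_real (- Im (F 0)) + of_real (measure M (- A)) * z
        + of_real (1 / pi) * (LINT t|\<mu>. nevanlinna_kernel z t)"
      by (simp add: scaleR_conv_of_real)
  qed (simp_all add: \<mu>_def)
  then show thesis by (rule that)
qed

section \<open>Poisson integrals and the Schwarz--Pick inequality\<close>

text \<open>The Poisson kernel of the half-plane without its factor \<open>Im z / pi\<close>, and
  with the weight \<open>1 + t\<^sup>2\<close> that belongs to the normalisation of \<mu> in the
  representation.\<close>

abbreviation poisson_kernel :: "complex \<Rightarrow> real \<Rightarrow> real" where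
  "poisson_kernel z t \<equiv> (1 + t\<^sup>2) / (norm (of_real t - z))\<^sup>2"

lemma Im_nevanlinna_kernel: "Im (nevanlinna_kernel z t) = Im z * poisson_kernel z t"
  unfolding Im_divide cmod_power2 by (simp add: power2_eq_square algebra_simps)

text \<open>The difference equals \<open>(z - w) * (1 + t\<^sup>2) / ((t - z) * (t - w))\<close>.
  The inequality \<open>2 * a * b \<le> a\<^sup>2 + b\<^sup>2\<close> separates the two denominators
  into one kernel for each point, and these integrate to imaginary parts of
  \<open>h\<close>.\<close>

lemma norm_nevanlinna_kernel_diff_le:
  assumes "Im z > 0" "Im w > 0"
  shows "norm (nevanlinna_kernel z t - nevanlinna_kernel w t)
           \<le> norm (z - w) * ((poisson_kernel z t + poisson_kernel w t) / 2)"
proof -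
  note ne = of_real_minus_nonreal(1)[OF assms(1), of t] of_real_minus_nonreal(1)[OF assms(2), of t]
  define a b where "a = 1 / norm (of_real t - z)" and "b = 1 / norm (of_real t - w)"
  have eq: "nevanlinna_kernel z t - nevanlinna_kernel w t
      = (z - w) * (of_real (1 + t\<^sup>2) / ((of_real t - z) * (of_real t - w)))"
    using ne by (simp add: divide_simps) (simp add: algebra_simps power2_eq_square)
  have "norm (nevanlinna_kernel z t - nevanlinna_kernel w t) = norm (z - w) * ((1 + t\<^sup>2) * (a * b))"
    unfolding eq norm_mult norm_divide norm_of_real a_def b_def by simp
  also have "\<dots> \<le> norm (z - w) * ((1 + t\<^sup>2) * ((a\<^sup>2 + b\<^sup>2) / 2))"
    using sum_squares_bound[of a b] by (intro mult_left_mono) auto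
  also have "(1 + t\<^sup>2) * ((a\<^sup>2 + b\<^sup>2) / 2) = (poisson_kernel z t + poisson_kernel w t) / 2"
    by (simp add: a_def b_def power_divide distrib_left)
  finally show ?thesis .
qed

locale nevanlinna =
  fixes h :: "complex \<Rightarrow> complex" and c d :: real and \<mu> :: "real measure"
  assumes representation: "nevanlinna_representation h c d \<mu>"
begin

sublocale finite_measure \<mu>
  using representation by (simp add: nevanlinna_representation_def)

lemma sets_eq [measurable_cong]: "sets \<mu> = sets borel"
  using representation by (simp add: nevanlinna_representation_def)

lemma space_eq [simp]: "space \<mu> = UNIV"
  using sets_eq_imp_space_eq[OF sets_eq] by simp

lemma d_nonneg: "0 \<le> d"
  using representation by (simp add: nevanlinna_representation_def)

lemma eq: "Im z > 0 \<Longrightarrow>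
    h z = of_real c + of_real d * z + of_real (1 / pi) * (LINT t|\<mu>. nevanlinna_kernel z t)"
  using representation by (simp add: nevanlinna_representation_def upper_half_plane_def)

lemma integrable_kernel: "Im z > 0 \<Longrightarrow> integrable \<mu> (nevanlinna_kernel z)"
  by (rule integrable_nevanlinna_kernel[OF finite_measure_axioms sets_eq])

lemma integrable_poisson_kernel:
  assumes "Im z > 0"
  shows "integrable \<mu> (poisson_kernel z)"
proof -
  have "integrable \<mu> (\<lambda>t. Im (nevanlinna_kernel z t) / Im z)"
    using integrable_kernel[OF assms] by (intro integrable_divide integrable_Im)
  then show ?thesis using assms by (simp add: Im_nevanlinna_kernel)
qed

lemma Im_eq:
  assumes "Im z > 0"
  shows "Im (h z) / Im z = d + 1 / pi * (LINT t|\<mu>. poisson_kernel z t)"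
proof -
  have "Im (LINT t|\<mu>. nevanlinna_kernel z t) = (LINT t|\<mu>. Im (nevanlinna_kernel z t))"
    by (rule integral_Im[OF integrable_kernel[OF assms], symmetric])
  also have "\<dots> = Im z * (LINT t|\<mu>. poisson_kernel z t)"
    unfolding Im_nevanlinna_kernel by (rule integral_mult_right_zero)
  finally show ?thesis
    using assms by (simp add: eq field_simps)
qed

lemma Im_nonneg: "Im z > 0 \<Longrightarrow> 0 \<le> Im (h z)"
  using Im_eq[of z] d_nonneg
    integral_nonneg_AE[of "poisson_kernel z" \<mu>]
  by (smt (verit) AE_I2 divide_nonneg_nonneg mult_nonneg_nonneg pi_ge_zero zero_le_divide_iff zero_le_power2)

text \<open>The Schwarz--Pick inequality, with the geometric mean relaxed to an arithmetic one.\<close>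

lemma norm_diff_le:
  assumes z: "Im z > 0" and w: "Im w > 0"
  shows "norm (h z - h w) \<le> norm (z - w) * ((Im (h z) / Im z + Im (h w) / Im w) / 2)"
proof -
  note int = integrable_kernel[OF z] integrable_kernel[OF w]
  note intP = integrable_poisson_kernel[OF z] integrable_poisson_kernel[OF w]
  have "norm (LINT t|\<mu>. nevanlinna_kernel z t - nevanlinna_kernel w t)
      \<le> (LINT t|\<mu>. norm (z - w) * ((poisson_kernel z t + poisson_kernel w t) / 2))"
    by (intro Bochner_Integration.integral_norm_bound_integral norm_nevanlinna_kernel_diff_le z w
        Bochner_Integration.integrable_diff int integrable_mult_right integrable_divide
        Bochner_Integration.integrable_add intP)
  also have "\<dots> = norm (z - w) * (((LINT t|\<mu>. poisson_kernel z t) + (LINT t|\<mu>. poisson_kernel w t)) / 2)"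
    unfolding integral_mult_right_zero integral_divide_zero Bochner_Integration.integral_add[OF intP] ..
  finally have *: "norm (LINT t|\<mu>. nevanlinna_kernel z t - nevanlinna_kernel w t) \<le> \<dots>" .
  have "h z - h w = of_real d * (z - w)
      + of_real (1 / pi) * (LINT t|\<mu>. nevanlinna_kernel z t - nevanlinna_kernel w t)"
    unfolding Bochner_Integration.integral_diff[OF int] eq[OF z] eq[OF w] by (simp only: algebra_simps)
  then have "norm (h z - h w) = norm (of_real d * (z - w)
      + of_real (1 / pi) * (LINT t|\<mu>. nevanlinna_kernel z t - nevanlinna_kernel w t))"
    by (rule arg_cong)
  also have "\<dots> \<le> d * norm (z - w)
      + 1 / pi * norm (LINT t|\<mu>. nevanlinna_kernel z t - nevanlinna_kernel w t)"
    by (rule order_trans[OF norm_triangle_ineq]) (use d_nonneg in \<open>simp add: norm_mult norm_divide\<close>)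
  also have "\<dots> \<le> d * norm (z - w) + 1 / pi *
      (norm (z - w) * (((LINT t|\<mu>. poisson_kernel z t) + (LINT t|\<mu>. poisson_kernel w t)) / 2))"
    by (rule add_left_mono, rule mult_left_mono[OF *]) simp
  also have "\<dots> = norm (z - w) * ((Im (h z) / Im z + Im (h w) / Im w) / 2)"
    unfolding Im_eq[OF z] Im_eq[OF w] by (simp add: field_simps)
  finally show ?thesis .
qed

text \<open>
  Here the growth \<open>O(y)\<close> of the imaginary part near the real axis is exploited: an interval of
  length \<open>2 y\<close> has mass \<open>O(y\<^sup>2)\<close>, so a bounded interval can be covered with total mass \<open>O(y)\<close>.
\<close>

lemma measure_interval_eq_0:
  assumes ab: "a < b" and y0: "y0 > 0"
    and bound: "\<And>x y. \<lbrakk>a \<le> x; x \<le> b; 0 < y; y \<le> y0\<rbrakk> \<Longrightarrow> Im (h (Complex x y)) / y \<le> K"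
  shows "measure \<mu> {a..b} = 0"
proof -
  have small: "measure \<mu> {x - y..x + y} \<le> 2 * pi * K * y\<^sup>2"
    if x: "a \<le> x" "x \<le> b" and y: "0 < y" "y \<le> y0" for x y
  proof -
    have z: "Im (Complex x y) > 0" using y by simp
    have "measure \<mu> {x - y..x + y} / (2 * y\<^sup>2) = (LINT t|\<mu>. indicator {x - y..x + y} t / (2 * y\<^sup>2))"
      by simp
    also have "\<dots> \<le> (LINT t|\<mu>. poisson_kernel (Complex x y) t)"
    proof (rule integral_mono[OF _ integrable_poisson_kernel[OF z]])
      show "integrable \<mu> (\<lambda>t. indicator {x - y..x + y} t / (2 * y\<^sup>2))"
        by (intro integrable_divide integrable_real_indicator) (simp_all add: sets_eq less_top[symmetric])
      fix t
      \<comment> \<open>Within distance \<open>y\<close> of \<open>x\<close> the squared denominator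
        is at most \<open>2 * y\<^sup>2\<close>, while the weight is at least 1.\<close>
      have "1 / (2 * y\<^sup>2) \<le> poisson_kernel (Complex x y) t" if "t \<in> {x - y..x + y}"
      proof (rule frac_le)
        have "(t - x)\<^sup>2 \<le> y\<^sup>2" by (rule abs_le_square_iff[THEN iffD1]) (use that in auto)
        then show "(norm (of_real t - Complex x y))\<^sup>2 \<le> 2 * y\<^sup>2"
          unfolding cmod_power2 by simp
        show "0 < (norm (of_real t - Complex x y))\<^sup>2"
          using of_real_minus_nonreal(1)[OF z] by simp
      qed auto
      then show "indicator {x - y..x + y} t / (2 * y\<^sup>2) \<le> poisson_kernel (Complex x y) t"
        by (simp split: split_indicator)
    qed
    also have "\<dots> \<le> pi * K"
    proof -
      have "1 / pi * (LINT t|\<mu>. poisson_kernel (Complex x y) t) \<le> K"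
        using bound[OF x y] Im_eq[OF z] d_nonneg by simp
      then show ?thesis by (simp add: divide_le_eq mult.commute)
    qed
    finally show ?thesis using y by (simp add: field_simps)
  qed
  define L where "L = b - a"
  have L: "L > 0" using ab by (simp add: L_def)
  \<comment> \<open>The grid with mesh \<open>L / n\<close> has \<open>n + 1\<close> points
    including both ends, and each point of the interval lies within one mesh of a grid point to its
    left. The bound is of order \<open>1 / n\<close>.\<close>
  have cover: "measure \<mu> {a..b} \<le> real (n + 1) * (2 * pi * K * (L / real n)\<^sup>2)"
    if n: "n > 0" "L / real n \<le> y0" for n :: nat
  proof -
    define y where "y = L / real n"
    have y: "0 < y" "y \<le> y0" "real n * y = L" using n L by (auto simp: y_def)
    define x where "x i = a + real i * y" for i :: nat
    have x: "a \<le> x i" "x i \<le> b" if "i \<le> n" for i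
    proof -
      have "real i * y \<le> real n * y" using that y by (intro mult_right_mono) auto
      then show "x i \<le> b" using y by (simp add: x_def L_def)
      show "a \<le> x i" using y by (simp add: x_def)
    qed
    have sub: "{a..b} \<subseteq> (\<Union>i\<in>{..n}. {x i - y..x i + y})"
    proof
      fix t assume t: "t \<in> {a..b}"
      define i where "i = nat \<lfloor>(t - a) / y\<rfloor>"
      have nn: "0 \<le> (t - a) / y" using t y by simp
      have i: "real i \<le> (t - a) / y" "(t - a) / y < real i + 1"
        unfolding i_def using nn by linarith+
      have "(t - a) / y \<le> real n" using t y by (simp add: divide_simps L_def)
      with i have "i \<le> n" by linarith
      moreover have "real i * y \<le> t - a" "t - a < real i * y + y"
        using i y by (simp_all add: field_simps)
      then have "t \<in> {x i - y..x i + y}" using y by (simp add: x_def)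
      ultimately show "t \<in> (\<Union>i\<in>{..n}. {x i - y..x i + y})" by blast
    qed
    have "measure \<mu> {a..b} \<le> measure \<mu> (\<Union>i\<in>{..n}. {x i - y..x i + y})"
      by (rule finite_measure_mono[OF sub]) simp
    also have "\<dots> \<le> (\<Sum>i\<in>{..n}. measure \<mu> {x i - y..x i + y})"
      by (rule finite_measure_subadditive_finite) auto
    also have "\<dots> \<le> (\<Sum>i\<in>{..n}. 2 * pi * K * y\<^sup>2)"
      by (intro sum_mono small x y) auto
    finally show ?thesis by (simp add: y_def)
  qed
  have "eventually (\<lambda>n. L / real n \<le> y0) sequentially"
    using y0 by real_asymp
  then have "eventually (\<lambda>n. measure \<mu> {a..b} \<le> real (n + 1) * (2 * pi * K * (L / real n)\<^sup>2)) sequentially"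
    using eventually_gt_at_top[of 0] by eventually_elim (rule cover)
  moreover have "(\<lambda>n. real (n + 1) * (2 * pi * K * (L / real n)\<^sup>2)) \<longlonglongrightarrow> 0"
  proof -
    have "(\<lambda>n. real (n + 1) * (L / real n)\<^sup>2) \<longlonglongrightarrow> 0"
      using L by real_asymp
    from tendsto_mult_right_zero[OF this, of "2 * pi * K"] show ?thesis
      by (simp only: mult_ac)
  qed
  ultimately have "measure \<mu> {a..b} \<le> 0"
    by (intro tendsto_lowerbound[OF _ _ sequentially_bot])
  then show ?thesis by (simp add: measure_le_0_iff)
qed

end

section \<open>Consequences of the second Pick condition\<close>

text \<open>The inequality in the second assumption says that \<open>- z * h z\<close> has
  non-negative imaginary part, written out in real and imaginary parts.\<close>

locale stieltjes_nevanlinna = nevanlinna +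
  assumes cont: "continuous_on upper_half_plane h"
    and Im_times_nonpos: "\<And>z. Im z > 0 \<Longrightarrow> Re z * Im (h z) + Im z * Re (h z) \<le> 0"
begin

lemma Re_nonpos:
  assumes "Im z > 0" "Re z \<ge> 0"
  shows "Re (h z) \<le> 0"
proof -
  have "Im z * Re (h z) \<le> 0"
    using Im_times_nonpos[OF assms(1)] mult_nonneg_nonneg[OF assms(2) Im_nonneg[OF assms(1)]]
    by linarith
  then show ?thesis using assms(1) by (simp add: mult_le_0_iff)
qed

text \<open>At \<open>z = x * (1 + \<i>)\<close> the quotient \<open>h z / x\<close> tends to
  \<open>d * (1 + \<i>)\<close>, while its real part stays non-positive. The diagonal is chosen
  because on the imaginary axis \<open>d * z\<close> has no real part.\<close>

lemma d_eq_0: "d = 0"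
proof -
  define z where "z n = Complex (real (Suc n)) (real (Suc n))" for n
  have Im_z: "Im (z n) > 0" for n by (simp add: z_def)
  have norm_z: "norm (z n) \<le> 2 * real (Suc n)" for n
    using cmod_le[of "z n"] by (simp add: z_def)
  let ?f = "\<lambda>n t. nevanlinna_kernel (z n) t / of_real (real (Suc n))"
  have "(\<lambda>n. LINT t|\<mu>. ?f n t) \<longlonglongrightarrow> (LINT t|\<mu>. 0)"
  \<comment> \<open>With \<open>x = n + 1\<close>, the kernel bound is at most \<open>2 * x\<close>
    from \<open>norm z\<close> plus \<open>5 * x\<close> from
    \<open>norm (1 + z\<^sup>2) / x\<close>.\<close>
  proof (rule integral_dominated_convergence[where w = "\<lambda>_. 7"])
    show "AE t in \<mu>. norm (?f n t) \<le> 7" for n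
    proof (rule AE_I2)
      fix t
      let ?x = "real (Suc n)"
      have "norm (nevanlinna_kernel (z n) t) \<le> norm (z n) + norm (1 + (z n)\<^sup>2) / ?x"
        using nevanlinna_kernel_bound[OF Im_z[of n], of t] by (simp add: z_def)
      also have "norm (1 + (z n)\<^sup>2) \<le> 1 + (2 * ?x)\<^sup>2"
        using norm_triangle_ineq[of 1 "(z n)\<^sup>2"] power_mono[OF norm_z[of n] norm_ge_zero, of 2]
        unfolding norm_power norm_one by linarith
      also have "\<dots> \<le> 5 * ?x * ?x"
      proof -
        have "1 * 1 \<le> ?x * ?x" by (rule mult_mono) auto
        then show ?thesis by (simp only: power2_eq_square)
      qed
      finally have "norm (nevanlinna_kernel (z n) t) \<le> norm (z n) + 5 * ?x * ?x / ?x"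
        by (simp add: divide_right_mono)
      also have "\<dots> \<le> 7 * ?x" using norm_z[of n] by simp
      finally show "norm (?f n t) \<le> 7"
        unfolding norm_divide[of _ "of_real ?x"] norm_of_real by (simp add: pos_divide_le_eq)
    qed
    show "AE t in \<mu>. (\<lambda>n. ?f n t) \<longlonglongrightarrow> 0"
    proof (rule AE_I2, rule Lim_null_comparison)
      fix t
      show "\<forall>\<^sub>F n in sequentially. norm (?f n t)
          \<le> (1 + \<bar>t\<bar> * (2 * real (Suc n))) / real (Suc n) / real (Suc n)"
      proof (rule always_eventually, rule allI)
        fix n
        let ?x = "real (Suc n)"
        have "norm (1 + of_real t * z n) \<le> 1 + \<bar>t\<bar> * (2 * ?x)"
          using norm_triangle_ineq[of 1 "of_real t * z n"] mult_left_mono[OF norm_z[of n], of "\<bar>t\<bar>"]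
          by (simp add: norm_mult del: of_nat_Suc)
        moreover have "?x \<le> norm (of_real t - z n)"
          using of_real_minus_nonreal(2)[OF Im_z[of n], of t] by (simp add: z_def)
        ultimately have "norm (nevanlinna_kernel (z n) t) \<le> (1 + \<bar>t\<bar> * (2 * ?x)) / ?x"
          unfolding norm_divide by (intro frac_le) auto
        then show "norm (?f n t) \<le> (1 + \<bar>t\<bar> * (2 * ?x)) / ?x / ?x"
          unfolding norm_divide[of _ "of_real ?x"] norm_of_real abs_of_nat by (intro divide_right_mono) auto
      qed
      show "(\<lambda>n. (1 + \<bar>t\<bar> * (2 * real (Suc n))) / real (Suc n) / real (Suc n)) \<longlonglongrightarrow> 0"
        by real_asymp
    qed
  qed (simp_all add: measurable_cong_sets[OF sets_eq refl])
  then have kernel_lim: "(\<lambda>n. LINT t|\<mu>. ?f n t) \<longlonglongrightarrow> 0" by simp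
  have lim: "(\<lambda>n. Re (of_real (c / real (Suc n)) + of_real d * (1 + \<i>)
          + of_real (1 / pi) * (LINT t|\<mu>. ?f n t)))
        \<longlonglongrightarrow> Re (of_real 0 + of_real d * (1 + \<i>) + of_real (1 / pi) * 0)"
  proof (intro tendsto_Re tendsto_add tendsto_mult tendsto_const kernel_lim tendsto_of_real)
    show "(\<lambda>n. c / real (Suc n)) \<longlonglongrightarrow> 0" by real_asymp
  qed
  have lhs: "of_real (c / real (Suc n)) + of_real d * (1 + \<i>)
          + of_real (1 / pi) * (LINT t|\<mu>. ?f n t) = h (z n) / of_real (real (Suc n))" for n
  proof -
    let ?x = "of_real (real (Suc n)) :: complex"
    have "z n = ?x * (1 + \<i>)" "?x \<noteq> 0" by (simp_all add: z_def complex_eq_iff)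
    then show ?thesis
      unfolding eq[OF Im_z] integral_divide_zero of_real_divide
      by (simp add: add_divide_distrib del: of_nat_Suc)
  qed
  have "Re (of_real 0 + of_real d * (1 + \<i>) + of_real (1 / pi) * 0) = d" by simp
  from lim[unfolded lhs this] have "(\<lambda>n. Re (h (z n) / of_real (real (Suc n)))) \<longlonglongrightarrow> d" .
  moreover have "Re (h (z n) / of_real (real (Suc n))) \<le> 0" for n
    unfolding Re_divide_of_real using Re_nonpos[OF Im_z, of n]
    by (simp add: z_def divide_nonpos_pos)
  ultimately have "d \<le> 0"
    by (intro LIMSEQ_le_const2) auto
  then show ?thesis using d_nonneg by simp
qed

text \<open>The second Pick condition gives \<open>Re z * Im (h z) \<le> - Im z * Re (h z)\<close>.
  Thus any bound on \<open>h\<close> near the positive half-axis yields the decay of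
  \<open>Im h\<close> that makes intervals null.\<close>

lemma Im_div_le:
  assumes "Im z > 0" "Re z > 0"
  shows "Im (h z) / Im z \<le> norm (h z) / Re z"
proof -
  have "- Re (h z) \<le> norm (h z)" using abs_Re_le_cmod[of "h z"] by linarith
  then have "Im z * (- Re (h z)) \<le> Im z * norm (h z)"
    using assms by (intro mult_left_mono) auto
  then have "Re z * Im (h z) \<le> Im z * norm (h z)"
    using Im_times_nonpos[OF assms(1)] by simp
  then show ?thesis using assms by (simp add: field_simps)
qed

text \<open>
  The Schwarz--Pick inequality together with \<open>Im_div_le\<close> keeps \<open>h\<close> bounded along the
  vertical segments that end on the positive half-axis.
\<close>

lemma norm_le_vertical:
  assumes x: "0 < a" "a \<le> x" and y: "0 < y" "y \<le> a"
  shows "norm (h (Complex x y)) \<le> 3 * norm (h (Complex x a))"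
proof -
  let ?z = "Complex x y" and ?w = "Complex x a"
  have "norm (h ?z - h ?w) \<le> norm (?z - ?w) * ((Im (h ?z) / Im ?z + Im (h ?w) / Im ?w) / 2)"
    by (rule norm_diff_le) (use x y in auto)
  \<comment> \<open>The distance \<open>a - y\<close> is at most \<open>x\<close>, which cancels the
    \<open>1 / x\<close> from \<open>Im_div_le\<close>.\<close>
  also have "\<dots> \<le> x * ((norm (h ?z) / x + norm (h ?w) / x) / 2)"
  proof (rule mult_mono)
    have "?z - ?w = Complex 0 (y - a)" by (simp add: complex_eq_iff)
    then show "norm (?z - ?w) \<le> x" using x y by (simp add: complex_norm)
    show "(Im (h ?z) / Im ?z + Im (h ?w) / Im ?w) / 2 \<le> (norm (h ?z) / x + norm (h ?w) / x) / 2"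
      using Im_div_le[of ?z] Im_div_le[of ?w] x y by (intro divide_right_mono add_mono) simp_all
    show "0 \<le> (Im (h ?z) / Im ?z + Im (h ?w) / Im ?w) / 2"
      using Im_nonneg[of ?z] Im_nonneg[of ?w] x y by simp
  qed (use x in auto)
  also have "\<dots> = (norm (h ?z) + norm (h ?w)) / 2"
    using x by (simp add: field_simps)
  \<comment> \<open>The factor 1/2 leaves half of \<open>norm (h ?z)\<close> on the left after
    absorption, hence the constant 3.\<close>
  finally have "norm (h ?z - h ?w) \<le> (norm (h ?z) + norm (h ?w)) / 2" .
  from order_trans[OF norm_triangle_ineq2 this] show ?thesis by simp
qed

text \<open>By compactness \<open>h\<close> is bounded on the horizontal segment at height
  \<open>a\<close>. The vertical estimate carries the bound down to the real axis, so
  \<open>Im h / y\<close> is bounded by \<open>3 * C / a\<close>.\<close>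

lemma measure_Icc_pos_eq_0:
  assumes ab: "0 < a" "a < b"
  shows "measure \<mu> {a..b} = 0"
proof -
  have "compact ((\<lambda>x. h (Complex x a)) ` {a..b})"
  proof (rule compact_continuous_image[OF continuous_on_compose2[OF cont]])
    show "continuous_on {a..b} (\<lambda>x. Complex x a)"
      unfolding Complex_eq by (intro continuous_intros)
  qed (use ab in \<open>auto simp: upper_half_plane_def\<close>)
  from compact_imp_bounded[OF this, unfolded bounded_iff]
  obtain C where "\<forall>v\<in>(\<lambda>x. h (Complex x a)) ` {a..b}. norm v \<le> C" ..
  then have C: "norm (h (Complex x a)) \<le> C" if "x \<in> {a..b}" for x
    using that by (rule bspec[OF _ imageI])
  show ?thesis
  proof (rule measure_interval_eq_0[OF ab(2,1)])
    fix x y assume xy: "a \<le> x" "x \<le> b" "0 < y" "y \<le> a"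
    have "Im (h (Complex x y)) / y \<le> norm (h (Complex x y)) / x"
      using Im_div_le[of "Complex x y"] xy ab by simp
    also have "\<dots> \<le> 3 * C / a"
      using norm_le_vertical[OF ab(1) xy(1,3,4)] C[of x] xy ab
      by (intro frac_le) (auto intro: order_trans[OF norm_ge_zero])
    finally show "Im (h (Complex x y)) / y \<le> 3 * C / a" .
  qed
qed

lemma emeasure_pos_eq_0: "emeasure \<mu> {0<..} = 0"
proof -
  \<comment> \<open>The shift by 2 keeps the left end strictly below the right end for every
    \<open>n\<close>.\<close>
  have "{0<..} = (\<Union>n. {1 / real (n + 2)..real (n + 2)})"
  proof (intro set_eqI iffI)
    fix t :: real assume "t \<in> {0<..}"
    then obtain n m :: nat where "1 / real (Suc n) < t" "t \<le> real m"
      using reals_Archimedean[of t] real_arch_simple[of t] by (auto simp: inverse_eq_divide)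
    moreover have "1 / real (n + m + 2) \<le> 1 / real (Suc n)"
      by (intro divide_left_mono) auto
    ultimately have "t \<in> {1 / real (n + m + 2)..real (n + m + 2)}" by auto
    then show "t \<in> (\<Union>n. {1 / real (n + 2)..real (n + 2)})" by blast
  next
    fix t :: real assume "t \<in> (\<Union>n. {1 / real (n + 2)..real (n + 2)})"
    then obtain n where n: "1 / real (n + 2) \<le> t" by auto
    have "0 < 1 / real (n + 2)" by simp
    with n show "t \<in> {0<..}" by (simp only: greaterThan_iff)
  qed
  moreover have "emeasure \<mu> (\<Union>n. {1 / real (n + 2)..real (n + 2)}) = 0"
  proof (rule emeasure_UN_eq_0)
    fix n :: nat
    have "1 / real (n + 2) < 1" by simp
    also have "1 < real (n + 2)" by simp
    finally show "emeasure \<mu> {1 / real (n + 2)..real (n + 2)} = 0"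
      using measure_Icc_pos_eq_0[of "1 / real (n + 2)" "real (n + 2)"]
      by (simp add: emeasure_eq_measure)
  qed (auto simp: sets_eq)
  ultimately show ?thesis by simp
qed

lemma AE_nonpos: "AE t in \<mu>. t \<le> 0"
  using emeasure_pos_eq_0 by (intro AE_I[of _ _ "{0<..}"]) (auto simp: sets_eq)

text \<open>On the imaginary axis \<open>Re h \<le> 0\<close> bounds the integrals of the real parts
  of the kernel by \<open>- c * pi\<close>. These real parts are non-negative for
  \<open>t \<le> 0\<close> and tend to \<open>- t\<close>, so Fatou's lemma gives integrability and
  the inequality together.\<close>

lemma integrable_id_and_constant_le: "integrable \<mu> (\<lambda>t. t)" "c \<le> 1 / pi * (LINT t|\<mu>. t)"
proof -
  \<comment> \<open>Starting at height 1 keeps the factor \<open>(n + 1)\<^sup>2 - 1\<close> in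
    \<open>k n\<close> non-negative for every \<open>n\<close>.\<close>
  define z where "z n = Complex 0 (real (Suc n))" for n
  have Im_z: "Im (z n) > 0" and Re_z: "Re (z n) = 0" for n by (simp_all add: z_def)
  define k where "k n t = Re (nevanlinna_kernel (z n) t)" for n t
  have k: "k n t = (- t) * (((real (Suc n))\<^sup>2 - 1) / (t\<^sup>2 + (real (Suc n))\<^sup>2))" for n t
    unfolding k_def z_def Re_divide by (simp add: power2_eq_square algebra_simps)
  have k_nonneg: "0 \<le> k n t" if "t \<le> 0" for n t
  proof -
    have "1 \<le> (real (Suc n))\<^sup>2" by (rule one_le_power) simp
    then show ?thesis
      unfolding k using that by (intro mult_nonneg_nonneg divide_nonneg_nonneg) simp_all
  qed
  have [measurable]: "k n \<in> borel_measurable borel" for n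
    unfolding k_def by measurable
  have k_int: "integrable \<mu> (k n)" for n
    unfolding k_def by (intro integrable_Re integrable_kernel Im_z)
  have AE_k: "AE t in \<mu>. 0 \<le> k n t" for n
    using AE_nonpos by eventually_elim (rule k_nonneg)
  have k_le: "(LINT t|\<mu>. k n t) \<le> - c * pi" for n
  proof -
    have "(LINT t|\<mu>. k n t) = Re (LINT t|\<mu>. nevanlinna_kernel (z n) t)"
      unfolding k_def by (rule integral_Re[OF integrable_kernel[OF Im_z]])
    moreover have "Re (h (z n)) \<le> 0" by (rule Re_nonpos) (auto simp: z_def)
    ultimately have "c + 1 / pi * (LINT t|\<mu>. k n t) \<le> 0"
      unfolding eq[OF Im_z] by (simp add: Re_z)
    then show ?thesis by (simp add: field_simps)
  qed
  \<comment> \<open>Since \<open>ennreal\<close> cuts negative values to 0 continuously, the limit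
    holds at every \<open>t\<close>, positive ones included.\<close>
  have "(\<integral>\<^sup>+t. ennreal (- t) \<partial>\<mu>) = (\<integral>\<^sup>+t. liminf (\<lambda>n. ennreal (k n t)) \<partial>\<mu>)"
  proof (rule nn_integral_cong)
    fix t :: real
    have "(\<lambda>n. k n t) \<longlonglongrightarrow> - t" unfolding k by real_asymp
    then have "(\<lambda>n. ennreal (k n t)) \<longlonglongrightarrow> ennreal (- t)" by (rule tendsto_ennrealI)
    then show "ennreal (- t) = liminf (\<lambda>n. ennreal (k n t))"
      by (rule lim_imp_Liminf[OF sequentially_bot, symmetric])
  qed
  also have "\<dots> \<le> liminf (\<lambda>n. \<integral>\<^sup>+t. ennreal (k n t) \<partial>\<mu>)"
    by (rule nn_integral_liminf) simp
  also have "\<dots> \<le> liminf (\<lambda>n. ennreal (- c * pi))"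
  proof (intro Liminf_mono always_eventually allI)
    fix n
    show "(\<integral>\<^sup>+t. ennreal (k n t) \<partial>\<mu>) \<le> ennreal (- c * pi)"
      by (subst nn_integral_eq_integral[OF k_int AE_k]) (rule ennreal_leI[OF k_le])
  qed
  also have "\<dots> = ennreal (- c * pi)" by (simp add: Liminf_const)
  finally have fatou: "(\<integral>\<^sup>+t. ennreal (- t) \<partial>\<mu>) \<le> ennreal (- c * pi)" .
  have AE_neg: "AE t in \<mu>. 0 \<le> - t" using AE_nonpos by simp
  have int: "integrable \<mu> (\<lambda>t. - t)"
    by (rule integrableI_nonneg[OF _ AE_neg le_less_trans[OF fatou]]) simp_all
  then show "integrable \<mu> (\<lambda>t. t)" using Bochner_Integration.integrable_minus[OF int] by simp
  \<comment> \<open>Needed to return from \<open>ennreal\<close> to the reals, because a negative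
    upper bound would have been cut to 0.\<close>
  have "0 \<le> - c * pi"
    using k_le[of 0] integral_nonneg_AE[OF AE_k[of 0]] by linarith
  moreover have "ennreal (LINT t|\<mu>. - t) \<le> ennreal (- c * pi)"
    using fatou unfolding nn_integral_eq_integral[OF int AE_neg] .
  ultimately have "(LINT t|\<mu>. - t) \<le> - c * pi" by (simp add: ennreal_le_iff)
  then show "c \<le> 1 / pi * (LINT t|\<mu>. t)" by (simp add: field_simps)
qed

end

section \<open>Stieltjes representation\<close>

lemma nn_integral_sum_measure:
  fixes f :: "'a \<Rightarrow> ennreal"
  assumes sets: "sets M1 = sets N" "sets M2 = sets N"
    and N: "\<And>A. A \<in> sets N \<Longrightarrow> emeasure N A = emeasure M1 A + emeasure M2 A"
    and f: "f \<in> borel_measurable N"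
  shows "(\<integral>\<^sup>+x. f x \<partial>N) = (\<integral>\<^sup>+x. f x \<partial>M1) + (\<integral>\<^sup>+x. f x \<partial>M2)"
  using f
proof (induction rule: borel_measurable_induct)
  note [measurable_cong] = sets
  note space = sets_eq_imp_space_eq[OF sets(1)] sets_eq_imp_space_eq[OF sets(2)]
  {
    case (cong f g)
    have "(\<integral>\<^sup>+x. f x \<partial>M) = (\<integral>\<^sup>+x. g x \<partial>M)" if "space M = space N" for M
      by (rule nn_integral_cong) (use cong that in auto)
    with cong show ?case using space by metis
  next
    case (set A)
    then show ?case by (simp add: N sets)
  next
    case (mult u c)
    then show ?case by (simp add: nn_integral_cmult distrib_left)
  next
    case (add u v)
    then show ?case by (simp add: nn_integral_add add_ac)
  next
    case (seq U)
    have [measurable]: "U i \<in> borel_measurable N" for i by (rule seq)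
    have mono: "incseq (\<lambda>i. integral\<^sup>N M (U i))" for M
      using \<open>incseq U\<close> by (auto simp: incseq_def le_fun_def intro!: nn_integral_mono)
    have SUP: "(\<integral>\<^sup>+x. (SUP i. U i) x \<partial>M) = (SUP i. integral\<^sup>N M (U i))"
      if [measurable_cong]: "sets M = sets N" for M
      unfolding SUP_apply by (rule nn_integral_monotone_convergence_SUP) (use \<open>incseq U\<close> in simp_all)
    show ?case
      unfolding SUP[OF refl] SUP[OF sets(1)] SUP[OF sets(2)] seq.IH
      by (rule ennreal_SUP_add[OF mono mono])
  }
qed

lemma integral_sum_measure:
  fixes f :: "'a \<Rightarrow> complex"
  assumes sets: "sets M1 = sets N" "sets M2 = sets N"
    and N: "\<And>A. A \<in> sets N \<Longrightarrow> emeasure N A = emeasure M1 A + emeasure M2 A"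
    and f: "integrable M1 f" "integrable M2 f"
  shows "integral\<^sup>L N f = integral\<^sup>L M1 f + integral\<^sup>L M2 f"
proof -
  note nn = nn_integral_sum_measure[OF sets N]
  have meas: "g \<in> borel_measurable N" if "g \<in> borel_measurable M1" for g :: "'a \<Rightarrow> 'b::topological_space"
    using that by (simp add: measurable_cong_sets[OF sets(1) refl])
  have real: "integral\<^sup>L N g = integral\<^sup>L M1 g + integral\<^sup>L M2 g \<and> integrable N g"
    if g: "integrable M1 g" "integrable M2 g" for g :: "'a \<Rightarrow> real"
  proof -
    have [measurable]: "g \<in> borel_measurable N"
      using g(1) by (intro meas) auto
    have fin: "(\<integral>\<^sup>+x. ennreal (g x) \<partial>M1) \<noteq> \<top>" "(\<integral>\<^sup>+x. ennreal (g x) \<partial>M2) \<noteq> \<top>"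
      "(\<integral>\<^sup>+x. ennreal (- g x) \<partial>M1) \<noteq> \<top>" "(\<integral>\<^sup>+x. ennreal (- g x) \<partial>M2) \<noteq> \<top>"
      using g by (simp_all add: real_integrable_def)
    have "integrable N g"
      unfolding real_integrable_def using fin by (simp add: nn)
    then show ?thesis
      using fin g by (simp add: real_lebesgue_integral_def nn enn2real_plus[unfolded less_top[symmetric]])
  qed
  note g = real[OF integrable_Re[OF f(1)] integrable_Re[OF f(2)]]
    real[OF integrable_Im[OF f(1)] integrable_Im[OF f(2)]]
  then have "integrable N (\<lambda>x. of_real (Re (f x)) + \<i> * of_real (Im (f x)))"
    by (intro Bochner_Integration.integrable_add integrable_mult_right integrable_of_real) auto
  then have "integrable N f" by (simp flip: complex_eq)
  with g f show ?thesis
    by (simp add: complex_eq_iff flip: integral_Re integral_Im)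
qed

text \<open>Used to add an atom at \<open>s = 0\<close> to the image of the Nevanlinna
  measure.\<close>

lemma sum_measure_exists:
  assumes sets: "sets M2 = sets M1"
  obtains N where "sets N = sets M1"
    "\<And>A. A \<in> sets N \<Longrightarrow> emeasure N A = emeasure M1 A + emeasure M2 A"
proof -
  define N where "N = measure_of (space M1) (sets M1) (\<lambda>A. emeasure M1 A + emeasure M2 A)"
  have sets_N: "sets N = sets M1" by (simp add: N_def)
  moreover have "emeasure N A = emeasure M1 A + emeasure M2 A" if "A \<in> sets N" for A
  proof (rule emeasure_measure_of[OF N_def sets.space_closed _ _ that])
    show "positive (sets N) (\<lambda>A. emeasure M1 A + emeasure M2 A)"
      by (simp add: positive_def)
    show "countably_additive (sets N) (\<lambda>A. emeasure M1 A + emeasure M2 A)"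
    proof (rule countably_additiveI)
      fix A :: "nat \<Rightarrow> 'a set"
      assume A: "range A \<subseteq> sets N" "disjoint_family A"
      have "(\<Sum>i. emeasure M1 (A i) + emeasure M2 (A i))
          = (\<Sum>i. emeasure M1 (A i)) + (\<Sum>i. emeasure M2 (A i))"
        by (rule suminf_add[symmetric]) (rule summableI)+
      with A show "(\<Sum>i. emeasure M1 (A i) + emeasure M2 (A i))
          = emeasure M1 (\<Union>i. A i) + emeasure M2 (\<Union>i. A i)"
        by (simp add: suminf_emeasure sets_N sets)
    qed
  qed
  ultimately show thesis by (rule that)
qed

text \<open>The Bochner integral of a non-integrable function is 0, so that case is trivial.\<close>

lemma Im_integral_nonneg:
  assumes "\<And>x. x \<in> space M \<Longrightarrow> 0 \<le> Im (f x)"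
  shows "0 \<le> Im (integral\<^sup>L M f)"
proof (cases "integrable M f")
  case True
  then have "Im (integral\<^sup>L M f) = (LINT x|M. Im (f x))" by (simp add: integral_Im)
  with assms show ?thesis by (simp add: Bochner_Integration.integral_nonneg)
qed (simp add: not_integrable_integral_eq)

section \<open>From the Stieltjes form to the two Pick conditions\<close>

text \<open>For s in [0,1] the imaginary parts of \<open>- 1 / (1 - s + s * z)\<close> and
  \<open>z / (1 - s + s * z)\<close> are \<open>s * Im z\<close> and \<open>(1 - s) * Im z\<close>,
  each divided by the squared modulus of the denominator. Both signs survive integration.\<close>

lemma stieltjes_integral_in_pick_class:
  assumes h: "h analytic_on upper_half_plane"
    and sets: "sets \<nu> = sets (restrict_space borel {0..1::real})"
    and rep: "\<And>z. z \<in> upper_half_plane \<Longrightarrow> h z = - (LINT s|\<nu>. 1 / (1 - of_real s + of_real s * z))"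
  shows "h \<in> pick_class" "(\<lambda>z. - (z * h z)) \<in> pick_class"
proof -
  have space: "space \<nu> = {0..1}"
    using sets_eq_imp_space_eq[OF sets] by (simp add: space_restrict_space)
  let ?g = "\<lambda>z s. 1 / (1 - of_real s + of_real s * z) :: complex"
  show "h \<in> pick_class"
    unfolding pick_class_def mem_Collect_eq
  proof (intro conjI ballI h)
    fix z assume z: "z \<in> upper_half_plane"
    have "0 \<le> Im (LINT s|\<nu>. - ?g z s)"
    proof (rule Im_integral_nonneg)
      fix s assume "s \<in> space \<nu>"
      then have "0 \<le> s * Im z" using z by (simp add: space upper_half_plane_def)
      then show "0 \<le> Im (- ?g z s)" by (simp add: Im_divide)
    qed
    then show "0 \<le> Im (h z)" by (simp add: rep[OF z])
  qed
  show "(\<lambda>z. - (z * h z)) \<in> pick_class"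
    unfolding pick_class_def mem_Collect_eq
  proof (intro conjI ballI)
    show "(\<lambda>z. - (z * h z)) analytic_on upper_half_plane"
      by (intro analytic_intros h)
    fix z assume z: "z \<in> upper_half_plane"
    have "0 \<le> Im (LINT s|\<nu>. z * ?g z s)"
    proof (rule Im_integral_nonneg)
      fix s assume "s \<in> space \<nu>"
      then have "0 \<le> (1 - s) * Im z" using z by (simp add: space upper_half_plane_def)
      then show "0 \<le> Im (z * ?g z s)"
        by (simp add: Im_divide algebra_simps)
    qed
    then show "0 \<le> Im (- (z * h z))"
      by (simp only: rep[OF z] integral_mult_right_zero mult_minus_right minus_minus)
  qed
qed

section \<open>From the Nevanlinna to the Stieltjes representation\<close>

context nevanlinna
begin

text \<open>
  The substitution \<open>s = 1 / (1 - t)\<close> carries the half-line \<open>t \<le> 0\<close> to \<open>0 < s \<le> 1\<close>; the slack in the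
  inequality for \<open>c\<close> becomes the mass of the point \<open>s = 0\<close>, which corresponds to \<open>t = -\<infinity>\<close>.
\<close>

lemma stieltjes_integral:
  assumes d: "d = 0" and neg: "emeasure \<mu> {0<..} = 0" and int_t: "integrable \<mu> (\<lambda>t. t)"
    and c: "c \<le> 1 / pi * (LINT t|\<mu>. t)"
  obtains \<nu> :: "real measure"
  where "finite_measure \<nu>" "sets \<nu> = sets (restrict_space borel {0..1})"
    "\<And>z. Im z > 0 \<Longrightarrow> h z = - (LINT s|\<nu>. 1 / (1 - of_real s + of_real s * z))"
proof -
  let ?B = "restrict_space borel {0..1::real}"
  have AE_neg: "AE t in \<mu>. t \<le> 0"
    using neg by (intro AE_I[of _ _ "{0<..}"]) (auto simp: sets_eq)
  define a where "a = 1 / pi * (LINT t|\<mu>. t) - c"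
  have a: "0 \<le> a" using c by (simp add: a_def)
  \<comment> \<open>For \<open>t \<le> 0\<close> the absolute value is \<open>- t\<close>; writing
    \<open>\<bar>t\<bar>\<close> keeps \<open>s\<close> in [0,1] and \<open>w\<close> non-negative
    on the whole line. The weight \<open>w\<close> is chosen so that the Stieltjes integrand becomes
    the Nevanlinna kernel up to sign, the factor \<open>1 / pi\<close> and an added
    \<open>t\<close>.\<close>
  define w s :: "real \<Rightarrow> real" where "w t = (1 + t\<^sup>2) / (pi * (1 + \<bar>t\<bar>))" and "s t = 1 / (1 + \<bar>t\<bar>)" for t
  have w_nonneg: "0 \<le> w t" for t by (simp add: w_def)
  have w_le: "w t \<le> (1 + \<bar>t\<bar>) / pi" for t
  proof -
    have "1 + t\<^sup>2 \<le> (1 + \<bar>t\<bar>) * (1 + \<bar>t\<bar>)" by (simp add: power2_eq_square algebra_simps)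
    then have "w t \<le> (1 + \<bar>t\<bar>) * (1 + \<bar>t\<bar>) / (pi * (1 + \<bar>t\<bar>))"
      unfolding w_def by (rule divide_right_mono) simp
    also have "\<dots> = (1 + \<bar>t\<bar>) / pi" by simp
    finally show ?thesis .
  qed
  have [measurable]: "w \<in> borel_measurable borel" unfolding w_def by measurable
  have "s \<in> borel_measurable borel" unfolding s_def by measurable
  moreover have "s t \<in> {0..1}" for t by (simp add: s_def)
  ultimately have s_meas: "s \<in> measurable borel ?B"
    by (intro measurable_restrict_space2) auto
  have [measurable]: "s \<in> measurable (density \<mu> w) ?B"
    using s_meas by (simp add: measurable_cong_sets[OF sets_eq refl])
  \<comment> \<open>The weight grows linearly, so finiteness of the new measure rests on the
    integrability of \<open>t\<close>.\<close>
  have w_int: "integrable \<mu> w"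
  proof (rule Bochner_Integration.integrable_bound[of _ "\<lambda>t. (1 + \<bar>t\<bar>) / pi"])
    show "integrable \<mu> (\<lambda>t. (1 + \<bar>t\<bar>) / pi)"
      by (intro integrable_divide Bochner_Integration.integrable_add integrable_const
          integrable_abs int_t)
    show "AE t in \<mu>. norm (w t) \<le> norm ((1 + \<bar>t\<bar>) / pi)"
    proof (rule AE_I2)
      fix t show "norm (w t) \<le> norm ((1 + \<bar>t\<bar>) / pi)"
        using w_le[of t] w_nonneg[of t] by simp
    qed
  qed measurable
  define \<nu>1 where "\<nu>1 = distr (density \<mu> w) ?B s"
  define \<nu>2 where "\<nu>2 = density (return ?B 0) (\<lambda>_. a)"
  obtain \<nu> where \<nu>: "sets \<nu> = sets \<nu>1"
    "\<And>A. A \<in> sets \<nu> \<Longrightarrow> emeasure \<nu> A = emeasure \<nu>1 A + emeasure \<nu>2 A"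
    by (rule sum_measure_exists[of \<nu>2 \<nu>1]) (simp add: \<nu>1_def \<nu>2_def, rule that)
  have sets_\<nu>: "sets \<nu> = sets ?B" by (simp add: \<nu> \<nu>1_def)
  have zero: "(0::real) \<in> space ?B" by (simp add: space_restrict_space)
  show thesis
  proof (rule that[OF _ sets_\<nu>])
    have "finite_measure (density \<mu> w)"
    proof
      have "emeasure (density \<mu> w) (space (density \<mu> w)) = (\<integral>\<^sup>+t. ennreal (w t) \<partial>\<mu>)"
        by (simp add: emeasure_density)
      also have "\<dots> = ennreal (LINT t|\<mu>. w t)"
        by (rule nn_integral_eq_integral[OF w_int]) (simp add: w_nonneg)
      finally show "emeasure (density \<mu> w) (space (density \<mu> w)) \<noteq> \<infinity>" by simp
    qed
    then have "finite_measure \<nu>1"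
      unfolding \<nu>1_def by (rule finite_measure.finite_measure_distr) measurable
    then have "emeasure \<nu>1 A \<noteq> \<infinity>" for A by (simp add: finite_measure.emeasure_finite)
    moreover have "emeasure \<nu>2 (space \<nu>2) \<noteq> \<infinity>"
      unfolding \<nu>2_def space_density emeasure_density_const[OF sets.top]
        prob_space.emeasure_space_1[OF prob_space_return[OF zero]] by simp
    moreover have "space \<nu> = space \<nu>2"
      by (rule sets_eq_imp_space_eq) (simp add: sets_\<nu> \<nu>2_def)
    moreover have "emeasure \<nu> (space \<nu>) = emeasure \<nu>1 (space \<nu>) + emeasure \<nu>2 (space \<nu>)"
      by (rule \<nu>(2)[OF sets.top])
    ultimately show "finite_measure \<nu>"
      by (intro finite_measureI) simp
    fix z :: complex assume z: "Im z > 0"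
    let ?g = "\<lambda>s. 1 / (1 - of_real s + of_real s * z) :: complex"
    have g: "?g \<in> borel_measurable ?B"
      by (rule measurable_restrict_space1) measurable
    have wg: "w t *\<^sub>R ?g (s t) = - (of_real (1 / pi) * (nevanlinna_kernel z t + of_real t))"
      if "t \<le> 0" for t
    proof -
      let ?t = "of_real t :: complex"
      note ne = of_real_minus_nonreal(1)[OF z, of t]
      have t1: "1 - ?t \<noteq> 0" using that by (metis of_real_1 of_real_diff of_real_eq_0_iff diff_eq_diff_less_eq diff_ge_0_iff_ge eq_iff_diff_eq_0 not_one_le_zero)
      have st: "of_real (s t) = 1 / (1 - ?t)" "of_real (w t) = (1 + ?t\<^sup>2) / (of_real pi * (1 - ?t))"
        using that by (simp_all add: s_def w_def)
      have "1 - 1 / u + 1 / u * z = (u - 1 + z) / u" if "u \<noteq> 0" for u :: complex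
        using that by (simp add: add_divide_distrib diff_divide_distrib)
      from this[OF t1] have den: "1 - 1 / (1 - ?t) + 1 / (1 - ?t) * z = - (?t - z) / (1 - ?t)"
        by simp
      have "n / (p * u) * (1 / (- q / u)) = - n / (p * q)" if "u \<noteq> 0" for n p q u :: complex
        using that by simp
      from this[OF t1] have "w t *\<^sub>R ?g (s t) = - (1 + ?t\<^sup>2) / (of_real pi * (?t - z))"
        unfolding scaleR_conv_of_real st den .
      \<comment> \<open>The added \<open>t\<close> integrates to the first moment of \<mu>, which
        the definition of \<open>a\<close> absorbs.\<close>
      also have "1 + ?t\<^sup>2 = (nevanlinna_kernel z t + ?t) * (?t - z)"
        using ne by (simp add: field_simps power2_eq_square)
      finally show ?thesis using ne by simp
    qed
    have wg_AE: "AE t in \<mu>. - (of_real (1 / pi) * (nevanlinna_kernel z t + of_real t)) = w t *\<^sub>R ?g (s t)"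
      using AE_neg by eventually_elim (rule wg[symmetric])
    have gs[measurable]: "(\<lambda>t. ?g (s t)) \<in> borel_measurable \<mu>"
      unfolding s_def by measurable
    note k = integrable_kernel[OF z]
    have int: "integrable \<mu> (\<lambda>t. - (of_real (1 / pi) * (nevanlinna_kernel z t + of_real t)))"
      by (intro Bochner_Integration.integrable_minus integrable_mult_right
          Bochner_Integration.integrable_add k integrable_of_real int_t)
    have wg_int: "integrable \<mu> (\<lambda>t. w t *\<^sub>R ?g (s t))"
      by (rule Bochner_Integration.integrable_cong_AE_imp[OF int _ wg_AE]) measurable
    have "integrable \<nu>1 ?g"
      unfolding \<nu>1_def using wg_int g
      by (simp add: integrable_distr_eq integrable_density w_nonneg)
    moreover have "integrable \<nu>2 ?g"
    proof -
      have "integrable (return ?B 0) ?g"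
        unfolding integrable_iff_bounded
      proof
        show "?g \<in> borel_measurable (return ?B 0)" using g by simp
        have "(\<integral>\<^sup>+s. ennreal (norm (?g s)) \<partial>return ?B 0) = ennreal (norm (?g 0))"
          by (rule nn_integral_return[OF zero]) (use g in measurable)
        then show "(\<integral>\<^sup>+s. ennreal (norm (?g s)) \<partial>return ?B 0) < \<infinity>" by simp
      qed
      then show ?thesis
        unfolding \<nu>2_def using g a by (subst integrable_density) auto
    qed
    ultimately have "(LINT s|\<nu>. ?g s) = (LINT s|\<nu>1. ?g s) + (LINT s|\<nu>2. ?g s)"
      by (intro integral_sum_measure) (simp_all add: \<nu>(2) sets_\<nu>, simp_all add: \<nu>1_def \<nu>2_def)
    also have "(LINT s|\<nu>1. ?g s) = (LINT t|\<mu>. w t *\<^sub>R ?g (s t))"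
    proof -
      have "(LINT s|\<nu>1. ?g s) = (LINT t|density \<mu> w. ?g (s t))"
        unfolding \<nu>1_def by (rule integral_distr[OF _ g]) measurable
      also have "\<dots> = (LINT t|\<mu>. w t *\<^sub>R ?g (s t))"
        by (rule integral_density[OF gs]) (simp_all add: w_nonneg)
      finally show ?thesis .
    qed
    also have "\<dots> = (LINT t|\<mu>. - (of_real (1 / pi) * (nevanlinna_kernel z t + of_real t)))"
      by (rule integral_cong_AE) (use wg_AE in \<open>auto simp: eq_commute\<close>)
    also have "\<dots> = - (of_real (1 / pi) * ((LINT t|\<mu>. nevanlinna_kernel z t) + of_real (LINT t|\<mu>. t)))"
      unfolding integral_minus integral_mult_right_zero
        Bochner_Integration.integral_add[OF k integrable_of_real[OF int_t]] integral_complex_of_real[symmetric] ..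
    \<comment> \<open>The integrand equals 1 at \<open>s = 0\<close>, so the atom contributes
      exactly its mass, independently of \<open>z\<close>.\<close>
    also have "(LINT s|\<nu>2. ?g s) = of_real a"
    proof -
      have "(LINT s|\<nu>2. ?g s) = (LINT s|return ?B 0. a *\<^sub>R ?g s)"
        unfolding \<nu>2_def using g a by (intro integral_density) auto
      also have "\<dots> = a *\<^sub>R ?g 0"
        by (rule integral_return[OF zero]) (use g in measurable)
      finally show ?thesis by (simp add: scaleR_conv_of_real)
    qed
    finally have \<nu>_eq: "(LINT s|\<nu>. ?g s)
        = - (of_real (1 / pi) * ((LINT t|\<mu>. nevanlinna_kernel z t) + of_real (LINT t|\<mu>. t))) + of_real a" .
    show "h z = - (LINT s|\<nu>. ?g s)"
      unfolding \<nu>_eq eq[OF z] by (simp add: d a_def algebra_simps)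
  qed
qed

end

theorem theorem5p3:
  fixes h :: "complex \<Rightarrow> complex"
  assumes "h analytic_on upper_half_plane"
  shows
    "(h \<in> pick_class \<and> (\<lambda>z. - (z * h z)) \<in> pick_class
        \<longleftrightarrow>
      h \<in> pick_class \<and>
        (\<exists>c d \<mu>. nevanlinna_representation h c d \<mu> \<and>
           d = 0 \<and>
           emeasure \<mu> {0<..} = 0 \<and>
           integrable \<mu> (\<lambda>t. t) \<and> c \<le> 1 / pi * (LINT t|\<mu>. t)))
     \<and>
     (h \<in> pick_class \<and> (\<lambda>z. - (z * h z)) \<in> pick_class
        \<longleftrightarrow>
      (\<exists>\<nu> :: real measure. finite_measure \<nu> \<and> sets \<nu> = sets (restrict_space borel {0..1}) \<and>
         (\<forall>z\<in>upper_half_plane.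
            h z = - (LINT s|\<nu>. 1 / (1 - of_real s + of_real s * z)))))"
  (is "(?pick \<longleftrightarrow> ?nevanlinna) \<and> (?pick \<longleftrightarrow> ?stieltjes)")
proof -
  \<comment> \<open>Three implications in a cycle yield both equivalences.\<close>
  have "?nevanlinna" if pick: ?pick
  proof -
    obtain c d \<mu> where "nevanlinna_representation h c d \<mu>"
      using nevanlinna_representation_exists pick by blast
    then interpret nevanlinna h c d \<mu> by unfold_locales
    interpret stieltjes_nevanlinna h c d \<mu>
    proof
      show "continuous_on upper_half_plane h"
        using assms analytic_imp_holomorphic holomorphic_on_imp_continuous_on by blast
      fix z assume "Im z > 0"
      then have "0 \<le> Im (- (z * h z))"
        using pick by (auto simp: pick_class_def upper_half_plane_def)
      then show "Re z * Im (h z) + Im z * Re (h z) \<le> 0" by simp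
    qed
    show ?thesis
      using pick representation d_eq_0 emeasure_pos_eq_0 integrable_id_and_constant_le by blast
  qed
  moreover have "?stieltjes" if ?nevanlinna
  proof -
    from that obtain c d \<mu> where rep: "nevanlinna_representation h c d \<mu>" and
      *: "d = 0" "emeasure \<mu> {0<..} = 0" "integrable \<mu> (\<lambda>t. t)" "c \<le> 1 / pi * (LINT t|\<mu>. t)"
      by blast
    interpret nevanlinna h c d \<mu> using rep by unfold_locales
    obtain \<nu> where "finite_measure \<nu>" "sets \<nu> = sets (restrict_space borel {0..1})"
      "\<And>z. Im z > 0 \<Longrightarrow> h z = - (LINT s|\<nu>. 1 / (1 - of_real s + of_real s * z))"
      by (rule stieltjes_integral[OF *]) (rule that)
    then show ?thesis by (auto simp: upper_half_plane_def)
  qed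
  moreover have ?pick if ?stieltjes
    using that stieltjes_integral_in_pick_class[OF assms] by blast
  ultimately show ?thesis by argo
qed

end
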